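(* Let $G$ be a finite abstract simplicial complex with first and second Barycentric refinement graphs $G_1$ and $G_2=(G_1)_1$. (a) For every vertex $y$ of $G_1$, the unit sphere $S(y)$ in $G_1$ is topologically equivalent to a unit sphere $S(x)$ in $G_2$ for some vertex $x$ of $G_2$. (b) For every vertex $x$ of $G_2$, the unit sphere $S(x)$ in $G_2$ is topologically equivalent to a unit sphere $S(y)$ in $G_1$ for some vertex $y$ of $G_1$.
   Context: A finite abstract simplicial complex $G$ is a finite set of non-empty finite sets (simplices) closed under taking non-empty subsets. The Barycentric refinement graph $G_1$ has the simplices of $G$ as vertices, two distinct simplices being adjacent if one is a subset of the other. A finite simple graph is regarded as a simplicial complex via its Whitney (clique) complex, whose simplices are the vertex sets of the non-empty complete subgraphs; $G_2$ is the Barycentric refinement graph of the Whitney complex of $G_1$. The unit sphere $S(x)$ of a vertex $x$ in a graph is the subgraph induced on the neighbors of $x$. Two graphs (complexes) are topologically equivalent if the geometric realizations of their (Whitney) complexes are homeomorphic. *)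

theory Defs
  imports
    "HOL-Analysis.Analysis"
    "Graph_Theory.Digraph_Component"
    "Graph_Theory.Pair_Digraph"
    "Graph_Theory.Kuratowski"
begin

(* The empty complex is allowed; the empty set is never a simplex. *)
definition finite_abstract_simplicial_complex :: "'a set set \<Rightarrow> bool" where
  "finite_abstract_simplicial_complex K \<longleftrightarrow>
     finite K \<and>
     (\<forall>s\<in>K. finite s \<and> s \<noteq> {}) \<and>
     (\<forall>s\<in>K. \<forall>t. t \<subseteq> s \<and> t \<noteq> {} \<longrightarrow> t \<in> K)"

(* Finite simple graphs are the structures satisfying the locale predicate graph:
   finite symmetric digraphs without loops and parallel arcs. *)

definition barycentric_graph :: "'a set set \<Rightarrow> ('a set, 'a set \<times> 'a set) pre_digraph" where
  "barycentric_graph K = with_proj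
     \<lparr> pverts = K,
       parcs = {(s, t). s \<in> K \<and> t \<in> K \<and> s \<noteq> t \<and> (s \<subseteq> t \<or> t \<subseteq> s)} \<rparr>"

definition whitney_complex :: "('a, 'b) pre_digraph \<Rightarrow> 'a set set" where
  "whitney_complex H =
     {A. A \<noteq> {} \<and> finite A \<and> A \<subseteq> verts H \<and> K\<^bsub>card A\<^esub> (H \<restriction> A)}"

definition barycentric_refinement ::
  "('a, 'b) pre_digraph \<Rightarrow> ('a set, 'a set \<times> 'a set) pre_digraph" where
  "barycentric_refinement H = barycentric_graph (whitney_complex H)"

definition unit_sphere :: "('a, 'b) pre_digraph \<Rightarrow> 'a \<Rightarrow> ('a, 'b) pre_digraph" where
  "unit_sphere H x = H \<restriction> {y. x \<rightarrow>\<^bsub>H\<^esub> y}"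

(* Barycentric coordinates.  The topology is that of pointwise convergence on functions to
   the reals; for a finite complex only finitely many coordinates are not identically zero,
   so this is the usual Euclidean topology.  The empty complex has empty realization. *)
definition geometric_realization :: "'a set set \<Rightarrow> ('a \<Rightarrow> real) set" where
  "geometric_realization K =
     {f. (\<forall>v. 0 \<le> f v) \<and> {v. f v \<noteq> 0} \<in> K \<and> (\<Sum>v | f v \<noteq> 0. f v) = 1}"

definition topologically_equivalent ::
  "('a, 'b) pre_digraph \<Rightarrow> ('c, 'd) pre_digraph \<Rightarrow> bool" where
  "topologically_equivalent H H' \<longleftrightarrow>
     geometric_realization (whitney_complex H) homeomorphic
     geometric_realization (whitney_complex H')"

lemma graph_barycentric_graph:
  assumes "finite K"
  shows "graph (barycentric_graph K)"
proof -
  let ?P = "\<lparr> pverts = K,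
    parcs = {(s, t). s \<in> K \<and> t \<in> K \<and> s \<noteq> t \<and> (s \<subseteq> t \<or> t \<subseteq> s)} \<rparr>"
  have "finite (parcs ?P)"
    by (rule finite_subset[of _ "K \<times> K"]) (use assms in auto)
  then have "pair_graph ?P"
    using assms by unfold_locales (auto simp: symmetric_def intro!: symI)
  then show ?thesis
    unfolding barycentric_graph_def by (rule pair_graph.pair_graphD_graph)
qed

lemma verts_barycentric_graph [simp]: "verts (barycentric_graph K) = K"
  by (simp add: barycentric_graph_def)

lemma barycentric_graph_dominates_iff:
  "s \<rightarrow>\<^bsub>barycentric_graph K\<^esub> t \<longleftrightarrow>
     s \<in> K \<and> t \<in> K \<and> s \<noteq> t \<and> (s \<subseteq> t \<or> t \<subseteq> s)"
  by (simp add: barycentric_graph_def)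

lemma graph_induce_subgraph:
  assumes "graph H" "A \<subseteq> verts H"
  shows "graph (H \<restriction> A)"
proof -
  interpret graph H by fact
  have "induced_subgraph (H \<restriction> A) H"
    using assms(2) by (rule induced_induce)
  then have "digraph (H \<restriction> A)" "symmetric (H \<restriction> A)"
    using sym_arcs by (blast intro: digraphI_induced induced_graph_imp_symmetric)+
  then show ?thesis
    by (simp add: graph_def pseudo_graph_def sym_digraph_def sym_digraph_axioms_def
        digraph_def fin_digraph_def)
qed

lemma whitney_complex_iff:
  assumes "graph H"
  shows "A \<in> whitney_complex H \<longleftrightarrow>
    A \<noteq> {} \<and> A \<subseteq> verts H \<and> (\<forall>u\<in>A. \<forall>v\<in>A. u \<noteq> v \<longrightarrow> u \<rightarrow>\<^bsub>H\<^esub> v)"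
proof -
  interpret graph H by fact
  have ends: "arcs_ends (H \<restriction> A) = {(u, v). u \<in> A \<and> v \<in> A \<and> u \<rightarrow>\<^bsub>H\<^esub> v}"
    by (auto simp: arcs_ends_def arc_to_ends_def)
  have neq: "u \<noteq> v" if "u \<rightarrow>\<^bsub>H\<^esub> v" for u v
    using that adj_not_same by auto
  have eq: "(arcs_ends (H \<restriction> A) = {(u, v). u \<in> A \<and> v \<in> A \<and> u \<noteq> v}) \<longleftrightarrow>
      (\<forall>u\<in>A. \<forall>v\<in>A. u \<noteq> v \<longrightarrow> u \<rightarrow>\<^bsub>H\<^esub> v)" (is "?l \<longleftrightarrow> ?r")
  proof
    assume l: ?l
    have "(u, v) \<in> arcs_ends (H \<restriction> A)" if "u \<in> A" "v \<in> A" "u \<noteq> v" for u v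
      unfolding l using that by simp
    then show ?r
      unfolding ends by simp
  next
    assume ?r
    then have "u \<in> A \<and> v \<in> A \<and> u \<rightarrow>\<^bsub>H\<^esub> v \<longleftrightarrow> u \<in> A \<and> v \<in> A \<and> u \<noteq> v" for u v
      using neq by fast
    then show ?l
      unfolding ends by simp
  qed
  show ?thesis
  proof (cases "A \<subseteq> verts H")
    case True
    then have "finite A"
      using finite_verts by (rule finite_subset)
    moreover have "graph (H \<restriction> A)"
      using graph_induce_subgraph[OF assms True] .
    ultimately show ?thesis
      by (simp add: whitney_complex_def complete_digraph_def True eq)
  next
    case False
    then show ?thesis
      by (simp add: whitney_complex_def)
  qed
qed

lemma finite_abstract_simplicial_complex_whitney_complex:
  assumes "graph H"
  shows "finite_abstract_simplicial_complex (whitney_complex H)"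
proof -
  interpret graph H by fact
  have "finite (whitney_complex H)"
    by (rule finite_subset[of _ "Pow (verts H)"]) (auto simp: whitney_complex_def)
  moreover have "t \<in> whitney_complex H"
    if "s \<in> whitney_complex H" "t \<subseteq> s" "t \<noteq> {}" for s t
    using that unfolding whitney_complex_iff[OF assms] by (metis subset_iff)
  moreover have "finite s \<and> s \<noteq> {}" if "s \<in> whitney_complex H" for s
    using that by (simp add: whitney_complex_def)
  ultimately show ?thesis
    unfolding finite_abstract_simplicial_complex_def by blast
qed

lemma verts_unit_sphere [simp]: "verts (unit_sphere H x) = {y. x \<rightarrow>\<^bsub>H\<^esub> y}"
  by (simp add: unit_sphere_def)

lemma graph_unit_sphere:
  assumes "graph H"
  shows "graph (unit_sphere H x)"
proof -
  interpret graph H by fact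
  show ?thesis
    unfolding unit_sphere_def
    by (rule graph_induce_subgraph[OF assms]) (auto dest: adj_in_verts)
qed

end

theory Submission
  imports Defs
begin

text \<open>The link of a point \<open>p\<close> of \<open>|K|\<close> can be read off the cone of tangent vectors \<open>v\<close> with
  \<open>p + \<epsilon>v \<in> |K|\<close> for small \<open>\<epsilon> > 0\<close>, taken up to positive scaling, and this cone depends only on the
  simplex \<open>s\<close> containing \<open>p\<close> in its interior. The unit sphere of a vertex of a graph is the link
  of that vertex. The barycentric subdivision map is linear on simplices and bijective, hence it
  identifies the cone of a chain \<open>x\<close> in the subdivision of \<open>K\<close> with the cone of its largest
  element \<open>\<Union>x\<close> in \<open>K\<close>. Applying this twice, the unit sphere of \<open>x\<close> in \<open>G\<^sub>2\<close> and that of \<open>\<Union>x\<close> in \<open>G\<^sub>1\<close>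
  are both homeomorphic to the link of \<open>\<Union>x\<close> in \<open>G\<close>; for \<open>x = {y}\<close> this gives part (a).\<close>

section \<open>Finite complexes and continuity of coordinates\<close>

lemma finite_complex: "finite_abstract_simplicial_complex K \<Longrightarrow> finite K"
  by (simp add: finite_abstract_simplicial_complex_def)

lemma simplex_finite_nonempty:
  "finite_abstract_simplicial_complex K \<Longrightarrow> s \<in> K \<Longrightarrow> finite s \<and> s \<noteq> {}"
  by (simp add: finite_abstract_simplicial_complex_def)

lemma finite_Union_complex: "finite_abstract_simplicial_complex K \<Longrightarrow> finite (\<Union>K)"
  using finite_complex simplex_finite_nonempty by blast

lemma continuous_on_coordinate [continuous_intros]:
  "continuous_on S (\<lambda>f :: 'a \<Rightarrow> 'b::topological_space. f a)"
  by (rule continuous_on_subset[OF continuous_on_product_coordinates]) simp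

section \<open>Layer decompositions along chains of simplices\<close>

text \<open>A superposition of indicator functions of simplices with weights \<open>q\<close>. For
  nonnegative weights supported on a chain it is the layer-cake form of a nonnegative function,
  whose layers are superlevel sets.\<close>

definition layer_sum :: "'a set set \<Rightarrow> ('a set \<Rightarrow> real) \<Rightarrow> 'a \<Rightarrow> real" where
  "layer_sum K q a = (\<Sum>z | z \<in> K \<and> a \<in> z. q z)"

lemma layer_sum_zero [simp]: "layer_sum K (\<lambda>z. 0) = (\<lambda>a. 0)"
  by (simp add: layer_sum_def fun_eq_iff)

lemma layer_sum_add: "layer_sum K (\<lambda>z. q z + r z) a = layer_sum K q a + layer_sum K r a"
  by (simp add: layer_sum_def sum.distrib)

lemma layer_sum_scale: "layer_sum K (\<lambda>z. c * q z) a = c * layer_sum K q a"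
  by (simp add: layer_sum_def sum_distrib_left)

text \<open>The sets of the support that do not contain \<open>s\<close> form a chain, so if there
  are any, one of them is largest. A point of \<open>s\<close> outside it lies in none of them, and
  its layer sum therefore counts supersets of \<open>s\<close> only.\<close>

lemma layer_sum_eq_superset_sum:
  assumes "finite K" "chain\<^sub>\<subseteq> {z. q z \<noteq> 0}" "s \<noteq> {}"
  shows "\<exists>a\<in>s. layer_sum K q a = (\<Sum>z | z \<in> K \<and> s \<subseteq> z. q z)"
proof -
  define M where "M = {z \<in> K. q z \<noteq> 0 \<and> \<not> s \<subseteq> z}"
  have "\<exists>a\<in>s. \<forall>z\<in>M. a \<notin> z"
  proof (cases "M = {}")
    case True
    then show ?thesis
      using assms(3) by auto
  next
    case False
    have "finite M"
      using assms(1) by (simp add: M_def)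
    then obtain m where m: "m \<in> M" "\<And>z. z \<in> M \<Longrightarrow> m \<subseteq> z \<Longrightarrow> m = z"
      using finite_has_maximal[of M] False by blast
    have "z \<subseteq> m" if "z \<in> M" for z
      using m that assms(2) unfolding M_def chain_subset_def by blast
    then show ?thesis
      using m(1) unfolding M_def by blast
  qed
  then obtain a where a: "a \<in> s" "\<forall>z\<in>M. a \<notin> z"
    by blast
  have "layer_sum K q a = (\<Sum>z | z \<in> K \<and> s \<subseteq> z. q z)"
    unfolding layer_sum_def
    by (rule sum.mono_neutral_right) (use assms(1) a in \<open>auto simp: M_def\<close>)
  then show ?thesis
    using a(1) by blast
qed

lemma superset_sum_le_layer_sum:
  assumes "finite K" "\<And>z. 0 \<le> q z" "a \<in> s"
  shows "(\<Sum>z | z \<in> K \<and> s \<subseteq> z. q z) \<le> layer_sum K q a"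
  unfolding layer_sum_def by (rule sum_mono2) (use assms in auto)

text \<open>The sum of \<open>q\<close> over the supersets of \<open>s\<close> is the minimum of the layer sum on \<open>s\<close>, so the
  layer sum determines \<open>q\<close> by downward induction.\<close>
lemma layer_sum_inj:
  assumes K: "finite_abstract_simplicial_complex K"
    and nonneg: "\<And>z. 0 \<le> q z" "\<And>z. 0 \<le> r z"
    and chain: "chain\<^sub>\<subseteq> {z. q z \<noteq> 0}" "chain\<^sub>\<subseteq> {z. r z \<noteq> 0}"
    and supp: "{z. q z \<noteq> 0} \<subseteq> K" "{z. r z \<noteq> 0} \<subseteq> K"
    and eq: "layer_sum K q = layer_sum K r"
  shows "q = r"
proof
  note fin = finite_complex[OF K] and simplex = simplex_finite_nonempty[OF K]
  \<comment> \<open>At the point of \<open>s\<close> where the layer sum of \<open>g\<close> equals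
    its superset sum, the layer sum of \<open>f\<close> has the same value and bounds the superset
    sum of \<open>f\<close> from above. Exchanging the roles gives equality.\<close>
  have le: "(\<Sum>z | z \<in> K \<and> s \<subseteq> z. f z) \<le> (\<Sum>z | z \<in> K \<and> s \<subseteq> z. g z)"
    if "\<And>z. 0 \<le> f z" "chain\<^sub>\<subseteq> {z. g z \<noteq> 0}" "layer_sum K f = layer_sum K g" "s \<noteq> {}" for s f g
    using layer_sum_eq_superset_sum[OF fin that(2,4)] superset_sum_le_layer_sum[OF fin, of f] that
    by metis
  have up: "(\<Sum>z | z \<in> K \<and> s \<subseteq> z. q z) = (\<Sum>z | z \<in> K \<and> s \<subseteq> z. r z)" if "s \<noteq> {}" for s
    using le[of q r] le[of r q] nonneg chain eq that by (simp add: antisym)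
  have "q s = r s" if "s \<in> K" for s
    using that
  proof (induction "card (\<Union>K) - card s" arbitrary: s rule: less_induct)
    case less
    have split: "(\<Sum>z | z \<in> K \<and> s \<subseteq> z. f z) = f s + (\<Sum>z | z \<in> K \<and> s \<subset> z. f z)" for f :: "'a set \<Rightarrow> real"
    proof -
      have "{z. z \<in> K \<and> s \<subseteq> z} = insert s {z. z \<in> K \<and> s \<subset> z}"
        using less.prems by auto
      then show ?thesis
        using fin by simp
    qed
    have "(\<Sum>z | z \<in> K \<and> s \<subset> z. q z) = (\<Sum>z | z \<in> K \<and> s \<subset> z. r z)"
    proof (rule sum.cong[OF refl])
      fix z assume z: "z \<in> {z. z \<in> K \<and> s \<subset> z}"
      then have "card s < card z" "card z \<le> card (\<Union>K)"
        using simplex fin by (auto intro!: psubset_card_mono card_mono)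
      then show "q z = r z"
        using less.hyps[of z] z by auto
    qed
    then show ?case
      using up[of s] split[of q] split[of r] simplex[OF less.prems] by simp
  qed
  then show "q s = r s" for s
    using supp by (metis (mono_tags) mem_Collect_eq subsetD)
qed

text \<open>Peeling off the lowest layer: the support \<open>S\<close> of \<open>p\<close> receives
  the least positive value \<open>m\<close> as its weight, and \<open>p'\<close>, which is
  \<open>p\<close> lowered by \<open>m\<close> and cut off at \<open>0\<close>, has smaller support.
  The zero function starts the induction, hence \<open>insert {} K\<close>.\<close>

lemma layer_sum_superlevel_sets:
  assumes K: "finite_abstract_simplicial_complex K"
    and "\<And>a. 0 \<le> p a" "{a. p a \<noteq> 0} \<in> insert {} K"
  obtains q where "\<And>z. 0 \<le> q z" "{z. q z \<noteq> 0} = {z. z \<noteq> {} \<and> (\<exists>t\<ge>0. z = {a. t < p a})}"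
    "layer_sum K q = p"
proof -
  note fin = finite_complex[OF K]
  have "\<exists>q. (\<forall>z. 0 \<le> q z) \<and> {z. q z \<noteq> 0} = {z. z \<noteq> {} \<and> (\<exists>t\<ge>0. z = {a. t < p a})} \<and>
      layer_sum K q = p"
    using assms(2,3)
  proof (induction "card {a. p a \<noteq> 0}" arbitrary: p rule: less_induct)
    case less
    define S where "S = {a. p a \<noteq> 0}"
    show ?case
    proof (cases "S = {}")
      case True
      then have "p = (\<lambda>a. 0)"
        by (auto simp: S_def)
      then show ?thesis
        by (intro exI[of _ "\<lambda>z. 0"]) auto
    next
      case False
      then have S: "S \<in> K" "finite S" and S_iff: "a \<in> S \<longleftrightarrow> 0 < p a" for a
        using less.prems K
        by (auto simp: S_def finite_abstract_simplicial_complex_def less_le)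
      define m where "m = Min (p ` S)"
      define p' where "p' a = max 0 (p a - m)" for a
      have "m \<in> p ` S"
        using S(2) False by (simp add: m_def)
      then obtain b where b: "b \<in> S" "p b = m"
        by auto
      have m: "0 < m" "\<And>a. a \<in> S \<Longrightarrow> m \<le> p a" "\<And>a. a \<notin> S \<Longrightarrow> p a = 0"
        using b S_iff[of b] S(2) by (auto simp: m_def S_def)
      have supp': "{a. p' a \<noteq> 0} \<subseteq> S - {b}"
        using b m by (auto simp: p'_def max_def split: if_splits) (use m in force)
      have "card {a. p' a \<noteq> 0} < card S"
        using supp' b(1) S(2) by (intro psubset_card_mono) auto
      moreover have "{a. p' a \<noteq> 0} \<in> insert {} K"
      proof (cases "{a. p' a \<noteq> 0} = {}")
        case False
        moreover have "{a. p' a \<noteq> 0} \<subseteq> S"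
          using supp' by auto
        ultimately have "{a. p' a \<noteq> 0} \<in> K"
          using S(1) K unfolding finite_abstract_simplicial_complex_def by metis
        then show ?thesis
          by (rule insertI2)
      qed (use insertI1 in metis)
      moreover have "0 \<le> p' a" for a
        by (simp add: p'_def)
      ultimately obtain q where q: "\<And>z. 0 \<le> q z"
        "{z. q z \<noteq> 0} = {z. z \<noteq> {} \<and> (\<exists>t\<ge>0. z = {a. t < p' a})}" "layer_sum K q = p'"
        using less.hyps[of p'] unfolding S_def by metis
      \<comment> \<open>The minimum is attained at \<open>b\<close>, so \<open>p' b = 0\<close> and
        \<open>S\<close> is not among the superlevel sets of \<open>p'\<close>. The new layer gets
        weight exactly \<open>m\<close>.\<close>
      have "q S = 0"
      proof (rule ccontr)
        assume "q S \<noteq> 0"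
        then obtain t where "0 \<le> t" "S = {a. t < p' a}"
          using q(2) by auto
        then show False
          using b supp' by force
      qed
      define r where "r z = q z + (if z = S then m else 0)" for z
      have r: "0 \<le> r z" for z
        using q(1) m(1) by (simp add: r_def)
      have "layer_sum K r a = p a" for a
      proof -
        have "layer_sum K (\<lambda>z. if z = S then m else 0) a = (if a \<in> S then m else 0)"
          using S(1) fin by (simp add: layer_sum_def)
        then show ?thesis
          using m(2,3)[of a] m(1) q(3) unfolding r_def layer_sum_add by (simp add: p'_def)
      qed
      moreover have "{z. r z \<noteq> 0} = {z. z \<noteq> {} \<and> (\<exists>t\<ge>0. z = {a. t < p a})}"
      proof -
        have rz: "r z \<noteq> 0 \<longleftrightarrow> z = S \<or> q z \<noteq> 0" for z
          using \<open>q S = 0\<close> m(1) by (auto simp: r_def)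
        \<comment> \<open>Below height \<open>m\<close> every superlevel set of \<open>p\<close> is
          \<open>S\<close>; from \<open>m\<close> on they are those of \<open>p'\<close> with the
          height shifted by \<open>m\<close>.\<close>
        have low: "{a. t < p a} = S" if "0 \<le> t" "t < m" for t
          using that m S_iff by (smt (verit, best) Collect_cong Collect_mem_eq)
        have high: "{a. t < p' a} = {a. t + m < p a}" if "0 \<le> t" for t
          using that by (auto simp: p'_def)
        have "q z \<noteq> 0 \<longleftrightarrow> z \<noteq> {} \<and> (\<exists>t\<ge>m. z = {a. t < p a})" for z
        proof -
          have "q z \<noteq> 0 \<longleftrightarrow> z \<noteq> {} \<and> (\<exists>t\<ge>0. z = {a. t + m < p a})"
          proof -
            have "q z \<noteq> 0 \<longleftrightarrow> z \<in> {z. z \<noteq> {} \<and> (\<exists>t\<ge>0. z = {a. t < p' a})}"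
              by (simp flip: q(2))
            then show ?thesis
              using high by (simp cong: conj_cong)
          qed
          also have "(\<exists>t\<ge>0. z = {a. t + m < p a}) \<longleftrightarrow> (\<exists>t\<ge>m. z = {a. t < p a})"
          proof (intro iffI; elim exE conjE)
            fix t assume "0 \<le> t" "z = {a. t + m < p a}"
            then show "\<exists>t\<ge>m. z = {a. t < p a}"
              by (intro exI[of _ "t + m"]) simp
          next
            fix t assume "m \<le> t" "z = {a. t < p a}"
            then show "\<exists>t\<ge>0. z = {a. t + m < p a}"
              by (intro exI[of _ "t - m"]) simp
          qed
          finally show ?thesis .
        qed
        moreover have "(\<exists>t\<ge>0. z = {a. t < p a}) \<longleftrightarrow> z = S \<or> (\<exists>t\<ge>m. z = {a. t < p a})" for z
        proof
          assume "\<exists>t\<ge>0. z = {a. t < p a}"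
          then obtain t where "0 \<le> t" "z = {a. t < p a}"
            by blast
          then show "z = S \<or> (\<exists>t\<ge>m. z = {a. t < p a})"
            using low[of t] by (cases "t < m") (simp, metis linorder_not_less)
        next
          assume "z = S \<or> (\<exists>t\<ge>m. z = {a. t < p a})"
          then show "\<exists>t\<ge>0. z = {a. t < p a}"
          proof
            assume "z = S"
            then show ?thesis
              using low[of 0] m(1) by (intro exI[of _ 0]) simp
          next
            assume "\<exists>t\<ge>m. z = {a. t < p a}"
            then obtain t where "m \<le> t" "z = {a. t < p a}"
              by blast
            then show ?thesis
              using m(1) by (intro exI[of _ t]) simp
          qed
        qed
        ultimately show ?thesis
          using rz False by auto
      qed
      ultimately show ?thesis
        using r by blast
    qed
  qed
  then show ?thesis
    using that by blast
qed

section \<open>Tangent cones and links at a simplex\<close>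

text \<open>At a point with support \<open>s\<close>, a small move may change coordinates in
  \<open>s\<close> in both directions but others only upwards. The support after the move is
  \<open>s \<union> {a. v a \<noteq> 0}\<close>, and zero sum preserves the total mass.\<close>

definition tangent_cone :: "'a set set \<Rightarrow> 'a set \<Rightarrow> ('a \<Rightarrow> real) set" where
  "tangent_cone K s =
     {v. (\<forall>a. a \<notin> s \<longrightarrow> 0 \<le> v a) \<and> s \<union> {a. v a \<noteq> 0} \<in> K \<and> sum v (\<Union>K) = 0}"

text \<open>Each ray of the cone is represented by its vector of l1 norm 1.\<close>

definition tangent_link :: "'a set set \<Rightarrow> 'a set \<Rightarrow> ('a \<Rightarrow> real) set" where
  "tangent_link K s = {v \<in> tangent_cone K s. (\<Sum>a\<in>\<Union>K. \<bar>v a\<bar>) = 1}"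

text \<open>The normalization to total mass 1 is dropped so that arbitrary multiples of positive
  vectors may be added.\<close>

definition open_star_cone :: "'a set set \<Rightarrow> 'a set \<Rightarrow> ('a \<Rightarrow> real) set" where
  "open_star_cone K s = {p. (\<forall>a. 0 \<le> p a) \<and> {a. p a \<noteq> 0} \<in> K \<and> s \<subseteq> {a. p a \<noteq> 0}}"

lemma tangent_cone_support: "v \<in> tangent_cone K s \<Longrightarrow> v a \<noteq> 0 \<Longrightarrow> a \<in> \<Union>K"
  unfolding tangent_cone_def by blast

lemma tangent_cone_scale: "v \<in> tangent_cone K s \<Longrightarrow> 0 < c \<Longrightarrow> (\<lambda>a. c * v a) \<in> tangent_cone K s"
  by (auto simp: tangent_cone_def simp flip: sum_distrib_left)

text \<open>Negative coordinates of \<open>v\<close> occur only in the finite set \<open>s\<close>,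
  where \<open>u\<close> is positive, so a large \<open>c\<close> outweighs them all. Up to scaling
  this is a step of length \<open>1 / c\<close> from \<open>u\<close> in direction
  \<open>v\<close>.\<close>

lemma tangent_cone_eventually_open_star:
  assumes K: "finite_abstract_simplicial_complex K" and v: "v \<in> tangent_cone K s"
    and u: "\<And>a. a \<in> s \<Longrightarrow> 0 < u a" "\<And>a. a \<notin> s \<Longrightarrow> u a = 0"
  shows "\<forall>\<^sub>F c in at_top. (\<lambda>a. v a + c * u a) \<in> open_star_cone K s"
proof -
  have "finite s"
    using v K finite_subset[of s "s \<union> {a. v a \<noteq> 0}"]
    by (auto simp: tangent_cone_def finite_abstract_simplicial_complex_def)
  moreover have "\<forall>\<^sub>F c in at_top. 0 < v a + c * u a" if "a \<in> s" for a
    using eventually_gt_at_top[of "- v a / u a"]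
    by eventually_elim (use u(1)[OF that] in \<open>simp add: field_simps\<close>)
  ultimately have "\<forall>\<^sub>F c in at_top. \<forall>a\<in>s. 0 < v a + c * u a"
    by (simp add: eventually_ball_finite)
  then show ?thesis
  proof eventually_elim
    case (elim c)
    have "v a + c * u a \<noteq> 0 \<longleftrightarrow> a \<in> s \<or> v a \<noteq> 0" for a
      using elim u(2)[of a] by (cases "a \<in> s") (auto simp: less_le)
    then have "{a. v a + c * u a \<noteq> 0} = s \<union> {a. v a \<noteq> 0}"
      by (simp add: set_eq_iff)
    moreover have "0 \<le> v a + c * u a" for a
      using elim u(2)[of a] v by (cases "a \<in> s") (auto simp: tangent_cone_def less_imp_le)
    ultimately show ?case
      using v by (simp add: open_star_cone_def tangent_cone_def)
  qed
qed

text \<open>Off \<open>s\<close> the multiple of \<open>u\<close> vanishes, so signs and support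
  there are already those of \<open>v\<close>. A single \<open>c\<close> of any size therefore
  suffices.\<close>

lemma open_star_tangent_cone:
  assumes p: "(\<lambda>a. v a + c * u a) \<in> open_star_cone K s"
    and u: "\<And>a. a \<notin> s \<Longrightarrow> u a = 0" and sum: "sum v (\<Union>K) = 0"
  shows "v \<in> tangent_cone K s"
proof -
  have "{a. v a + c * u a \<noteq> 0} = s \<union> {a. v a \<noteq> 0}"
    using p u by (force simp: open_star_cone_def)
  moreover have "0 \<le> v a" if "a \<notin> s" for a
    using p u[OF that] by (auto simp: open_star_cone_def dest: spec[of _ a])
  ultimately show ?thesis
    using p sum by (auto simp: open_star_cone_def tangent_cone_def)
qed

section \<open>The barycentric subdivision map on tangent cones\<close>

text \<open>The vertex \<open>z\<close> of the subdivision goes to the barycenter of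
  \<open>z\<close>. The linear extension is taken on all functions, so that it also acts on tangent
  vectors with negative coordinates.\<close>

definition barycentric_map :: "'a set set \<Rightarrow> ('a set \<Rightarrow> real) \<Rightarrow> 'a \<Rightarrow> real" where
  "barycentric_map K f = layer_sum K (\<lambda>z. f z / real (card z))"

lemma barycentric_map_add:
  "barycentric_map K (\<lambda>z. f z + g z) = (\<lambda>a. barycentric_map K f a + barycentric_map K g a)"
  by (simp add: barycentric_map_def layer_sum_add add_divide_distrib fun_eq_iff)

lemma barycentric_map_scale:
  "barycentric_map K (\<lambda>z. c * f z) = (\<lambda>a. c * barycentric_map K f a)"
  by (simp add: barycentric_map_def layer_sum_scale fun_eq_iff flip: times_divide_eq_right)

text \<open>Double counting: each simplex distributes its weight equally over its vertices. In
  particular vectors of sum zero keep sum zero.\<close>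

lemma sum_barycentric_map:
  assumes K: "finite_abstract_simplicial_complex K"
  shows "sum (barycentric_map K f) (\<Union>K) = sum f K"
proof -
  note fin = finite_complex[OF K] finite_Union_complex[OF K]
    and simplex = simplex_finite_nonempty[OF K]
  have "sum (barycentric_map K f) (\<Union>K)
      = (\<Sum>a\<in>\<Union>K. \<Sum>z | z \<in> K \<and> a \<in> z. f z / real (card z))"
    by (simp add: barycentric_map_def layer_sum_def)
  also have "\<dots> = (\<Sum>z\<in>K. \<Sum>a | a \<in> \<Union>K \<and> a \<in> z. f z / real (card z))"
    by (rule sum.swap_restrict) (use fin in auto)
  also have "\<dots> = (\<Sum>z\<in>K. \<Sum>a\<in>z. f z / real (card z))"
    by (intro sum.cong) auto
  also have "\<dots> = sum f K"
    using simplex by (intro sum.cong) auto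
  finally show ?thesis .
qed

lemma continuous_on_barycentric_map: "continuous_on S (barycentric_map K)"
  by (intro continuous_on_coordinatewise_then_product)
    (auto simp: barycentric_map_def layer_sum_def divide_inverse intro!: continuous_intros)

lemma whitney_barycentric_graph_iff:
  assumes "finite K"
  shows "c \<in> whitney_complex (barycentric_graph K) \<longleftrightarrow> c \<noteq> {} \<and> c \<subseteq> K \<and> chain\<^sub>\<subseteq> c"
  unfolding whitney_complex_iff[OF graph_barycentric_graph[OF assms]] verts_barycentric_graph
    barycentric_graph_dominates_iff chain_subset_def by blast

lemma Union_chain_mem:
  assumes "finite c" "c \<noteq> {}" "chain\<^sub>\<subseteq> c"
  shows "\<Union>c \<in> c"
proof -
  obtain m where m: "m \<in> c" "\<And>z. z \<in> c \<Longrightarrow> m \<subseteq> z \<Longrightarrow> m = z"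
    using finite_has_maximal[OF assms(1,2)] by blast
  have "z \<subseteq> m" if "z \<in> c" for z
    using m that assms(3) unfolding chain_subset_def by blast
  then have "\<Union>c = m"
    using m(1) by blast
  then show ?thesis
    using m(1) by simp
qed

lemma Union_whitney_barycentric_graph:
  assumes "finite K"
  shows "\<Union>(whitney_complex (barycentric_graph K)) = K"
proof -
  have "{s} \<in> whitney_complex (barycentric_graph K)" if "s \<in> K" for s
    using that by (simp add: whitney_barycentric_graph_iff[OF assms] chain_subset_def)
  moreover have "c \<subseteq> K" if "c \<in> whitney_complex (barycentric_graph K)" for c
    using that by (simp add: whitney_barycentric_graph_iff[OF assms])
  ultimately show ?thesis
    by blast
qed

text \<open>Nonnegative weights cannot cancel, so the support of the image is the union of the
  supporting chain, which is the largest member of that chain and hence a simplex.\<close>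

lemma barycentric_map_open_star:
  assumes K: "finite_abstract_simplicial_complex K"
    and f: "f \<in> open_star_cone (whitney_complex (barycentric_graph K)) x"
  shows "barycentric_map K f \<in> open_star_cone K (\<Union>x)"
proof -
  note fin = finite_complex[OF K] and simplex = simplex_finite_nonempty[OF K]
  define c where "c = {z. f z \<noteq> 0}"
  have c: "c \<noteq> {}" "c \<subseteq> K" "chain\<^sub>\<subseteq> c" "x \<subseteq> c" "\<And>z. 0 \<le> f z"
    using f by (auto simp: open_star_cone_def c_def whitney_barycentric_graph_iff[OF fin])
  have "barycentric_map K f a \<noteq> 0 \<longleftrightarrow> a \<in> \<Union>c" for a
  proof -
    have "barycentric_map K f a = 0 \<longleftrightarrow> (\<forall>z\<in>{z. z \<in> K \<and> a \<in> z}. f z / real (card z) = 0)"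
      unfolding barycentric_map_def layer_sum_def
      by (rule sum_nonneg_eq_0_iff) (use fin c(5) in auto)
    also have "\<dots> \<longleftrightarrow> a \<notin> \<Union>c"
      using c(2) simplex by (auto simp: c_def)
    finally show ?thesis
      by blast
  qed
  then have "{a. barycentric_map K f a \<noteq> 0} = \<Union>c"
    by (simp add: set_eq_iff)
  moreover have "\<Union>c \<in> K"
    using Union_chain_mem[of c] c fin finite_subset by blast
  moreover have "0 \<le> barycentric_map K f a" for a
    unfolding barycentric_map_def layer_sum_def by (rule sum_nonneg) (simp add: c(5))
  ultimately show ?thesis
    using c(4) by (auto simp: open_star_cone_def)
qed

text \<open>Division by cardinalities changes no support, so equal images are equal layer sums of
  nonnegative weights on chains, and \<open>layer_sum_inj\<close> recovers the weights.\<close>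

lemma barycentric_map_inj_on_open_star:
  assumes K: "finite_abstract_simplicial_complex K"
  shows "inj_on (barycentric_map K) (open_star_cone (whitney_complex (barycentric_graph K)) x)"
proof (rule inj_onI)
  fix f g
  assume fg: "f \<in> open_star_cone (whitney_complex (barycentric_graph K)) x"
    "g \<in> open_star_cone (whitney_complex (barycentric_graph K)) x"
    and eq: "barycentric_map K f = barycentric_map K g"
  note fin = finite_complex[OF K] and simplex = simplex_finite_nonempty[OF K]
  have supp: "{z. h z \<noteq> 0} \<subseteq> K" "chain\<^sub>\<subseteq> {z. h z \<noteq> 0}" "\<And>z. 0 \<le> h z"
    if "h \<in> open_star_cone (whitney_complex (barycentric_graph K)) x" for h
    using that by (auto simp: open_star_cone_def whitney_barycentric_graph_iff[OF fin])
  have div: "h z / real (card z) \<noteq> 0 \<longleftrightarrow> h z \<noteq> 0"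
    if "h \<in> open_star_cone (whitney_complex (barycentric_graph K)) x" for h z
    using supp(1)[OF that] simplex[of z] by (auto simp: card_gt_0_iff)
  have quot: "(\<lambda>z. f z / real (card z)) = (\<lambda>z. g z / real (card z))"
    by (rule layer_sum_inj[OF K])
      (use fg supp eq in \<open>simp_all only: div barycentric_map_def\<close>, simp_all)
  show "f = g"
  proof
    fix z
    show "f z = g z"
    proof (cases "z \<in> K")
      case True
      then show ?thesis
        using fun_cong[OF quot, of z] simplex[OF True] by simp
    next
      case False
      then show ?thesis
        using supp(1)[OF fg(1)] supp(1)[OF fg(2)] by (metis (mono_tags) mem_Collect_eq subsetD)
    qed
  qed
qed

text \<open>Tangent vectors are moved into the cone of nonnegative functions by adding a large multiple
  of a vector with support exactly the chain \<open>x\<close>; there the layer decompositions apply.\<close>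
lemma barycentric_map_bij_betw_tangent_cone:
  assumes K: "finite_abstract_simplicial_complex K"
    and x: "x \<in> whitney_complex (barycentric_graph K)"
  shows "bij_betw (barycentric_map K)
    (tangent_cone (whitney_complex (barycentric_graph K)) x) (tangent_cone K (\<Union>x))"
proof -
  let ?W = "whitney_complex (barycentric_graph K)"
  let ?b = "barycentric_map K"
  note fin = finite_complex[OF K] finite_Union_complex[OF K]
    and simplex = simplex_finite_nonempty[OF K]
  have W: "finite_abstract_simplicial_complex ?W"
    using fin(1) by (intro finite_abstract_simplicial_complex_whitney_complex graph_barycentric_graph)
  have x_props: "x \<noteq> {}" "x \<subseteq> K" "chain\<^sub>\<subseteq> x"
    using x by (auto simp: whitney_barycentric_graph_iff[OF fin(1)])
  \<comment> \<open>The factor \<open>card z\<close> cancels the division in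
    \<open>barycentric_map\<close>, so \<open>P\<close> counts the members of \<open>x\<close> that
    contain a point. Since \<open>x\<close> is a chain, this count is strictly larger on each member
    of \<open>x\<close> than outside it.\<close>
  define u where "u z = (if z \<in> x then real (card z) else 0)" for z
  define P where "P = ?b u"
  have u: "0 < u z" if "z \<in> x" for z
    using that simplex x_props by (auto simp: u_def card_gt_0_iff)
  have u0: "u z = 0" if "z \<notin> x" for z
    using that by (simp add: u_def)
  have P_card: "P a = real (card {z \<in> x. a \<in> z})" for a
  proof -
    have "P a = (\<Sum>z | z \<in> K \<and> a \<in> z. if z \<in> x then 1 else 0)"
      unfolding P_def barycentric_map_def layer_sum_def
      by (intro sum.cong) (use simplex x_props in \<open>auto simp: u_def\<close>)
    also have "\<dots> = (\<Sum>z\<in>{z. z \<in> K \<and> a \<in> z} \<inter> x. 1)"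
      using fin(1) by (subst sum.inter_restrict) auto
    also have "{z. z \<in> K \<and> a \<in> z} \<inter> x = {z \<in> x. a \<in> z}"
      using x_props by auto
    finally show ?thesis
      by simp
  qed
  have finx: "finite x"
    using x_props(2) fin(1) by (rule finite_subset)
  have P_pos: "0 < P a" if "a \<in> \<Union>x" for a
    using that finx by (auto simp: P_card card_gt_0_iff)
  have P_zero: "P a = 0" if "a \<notin> \<Union>x" for a
  proof -
    have "{z \<in> x. a \<in> z} = {}"
      using that by blast
    then show ?thesis
      unfolding P_card by (simp only: card.empty of_nat_0)
  qed
  have P_less: "P b < P a" if "z \<in> x" "a \<in> z" "b \<notin> z" for a b z
  proof -
    have "{z \<in> x. b \<in> z} \<subset> {z \<in> x. a \<in> z}"
      using that x_props(3) unfolding chain_subset_def by blast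
    then show ?thesis
      using finx by (simp add: P_card psubset_card_mono)
  qed
  have lin: "?b (\<lambda>z. v z + c * u z) = (\<lambda>a. ?b v a + c * P a)" for v c
    by (simp add: barycentric_map_add barycentric_map_scale P_def)
  have sumW: "sum v (\<Union>?W) = sum (?b v) (\<Union>K)" for v
    by (simp add: Union_whitney_barycentric_graph[OF fin(1)] sum_barycentric_map[OF K])
  have ev: "\<forall>\<^sub>F c in at_top. (\<lambda>z. v z + c * u z) \<in> open_star_cone ?W x"
    if "v \<in> tangent_cone ?W x" for v
    using tangent_cone_eventually_open_star[OF W that u u0] .
  \<comment> \<open>Adding \<open>c * u\<close> before the map amounts to adding
    \<open>c * P\<close> after it, so the claim is transferred from the nonnegative
    functions.\<close>
  have "?b v \<in> tangent_cone K (\<Union>x)" if v: "v \<in> tangent_cone ?W x" for v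
  proof -
    obtain c where "(\<lambda>z. v z + c * u z) \<in> open_star_cone ?W x"
      using eventually_happens[OF ev[OF v]] by auto
    then have "(\<lambda>a. ?b v a + c * P a) \<in> open_star_cone K (\<Union>x)"
      using barycentric_map_open_star[OF K] lin by metis
    then show ?thesis
      by (rule open_star_tangent_cone) (use P_zero v sumW in \<open>auto simp: tangent_cone_def\<close>)
  qed
  moreover have "inj_on ?b (tangent_cone ?W x)"
  proof (rule inj_onI)
    fix v w assume vw: "v \<in> tangent_cone ?W x" "w \<in> tangent_cone ?W x" and eq: "?b v = ?b w"
    obtain c where "(\<lambda>z. v z + c * u z) \<in> open_star_cone ?W x"
      "(\<lambda>z. w z + c * u z) \<in> open_star_cone ?W x"
      using eventually_happens[OF eventually_conj[OF ev[OF vw(1)] ev[OF vw(2)]]] by auto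
    then have "(\<lambda>z. v z + c * u z) = (\<lambda>z. w z + c * u z)"
      by (rule inj_onD[OF barycentric_map_inj_on_open_star[OF K], rotated]) (simp add: lin eq)
    then show "v = w"
      by (simp add: fun_eq_iff)
  qed
  \<comment> \<open>For large \<open>c\<close> the gaps of \<open>P\<close> dominate the differences
    of \<open>w\<close>, so every member of \<open>x\<close> is a superlevel set of
    \<open>p = w + c P\<close>. The layer decomposition of \<open>p\<close> then has positive weight
    on all of \<open>x\<close>.\<close>
  moreover have "\<exists>v\<in>tangent_cone ?W x. ?b v = w" if w: "w \<in> tangent_cone K (\<Union>x)" for w
  proof -
    have "\<forall>\<^sub>F c in at_top. w b + c * P b < w a + c * P a" if "z \<in> x" "a \<in> z" "b \<notin> z" for a b z
      using eventually_gt_at_top[of "(w b - w a) / (P a - P b)"]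
      by eventually_elim (use P_less[OF that] in \<open>simp add: field_simps\<close>)
    then have "\<forall>\<^sub>F c in at_top. \<forall>z\<in>x. \<forall>a\<in>z. \<forall>b\<in>\<Union>K - z. w b + c * P b < w a + c * P a"
      using finx fin(2) simplex x_props by (intro eventually_ball_finite ballI) auto
    moreover have "\<forall>\<^sub>F c in at_top. (\<lambda>a. w a + c * P a) \<in> open_star_cone K (\<Union>x)"
      using K w P_pos P_zero by (rule tangent_cone_eventually_open_star)
    ultimately have "\<forall>\<^sub>F c in at_top. (\<forall>z\<in>x. \<forall>a\<in>z. \<forall>b\<in>\<Union>K - z. w b + c * P b < w a + c * P a) \<and>
        (\<lambda>a. w a + c * P a) \<in> open_star_cone K (\<Union>x)"
      by (rule eventually_conj)
    from eventually_happens[OF this] obtain c where gap: "\<And>z a b. z \<in> x \<Longrightarrow> a \<in> z \<Longrightarrow> b \<in> \<Union>K - z \<Longrightarrow>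
          w b + c * P b < w a + c * P a"
      and star: "(\<lambda>a. w a + c * P a) \<in> open_star_cone K (\<Union>x)"
      by (metis trivial_limit_at_top_linorder)
    define p where "p a = w a + c * P a" for a
    have p: "\<And>a. 0 \<le> p a" "{a. p a \<noteq> 0} \<in> K" "\<And>a. a \<in> \<Union>x \<Longrightarrow> 0 < p a"
      using star by (auto simp: open_star_cone_def p_def less_le)
    obtain q where q: "\<And>z. 0 \<le> q z"
      "{z. q z \<noteq> 0} = {z. z \<noteq> {} \<and> (\<exists>t\<ge>0. z = {a. t < p a})}" "layer_sum K q = p"
      using layer_sum_superlevel_sets[OF K, of p] p by auto
    have "q z \<noteq> 0" if "z \<in> x" for z
    proof -
      have zK: "z \<in> K" "finite z" "z \<noteq> {}"
        using that x_props simplex by auto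
      \<comment> \<open>The highest value of \<open>p\<close> outside \<open>z\<close>. Including
        \<open>0\<close> makes \<open>t\<close> nonnegative and covers the case that
        \<open>z\<close> contains all vertices.\<close>
      define t where "t = Max (insert 0 (p ` (\<Union>K - z)))"
      have "0 \<le> t"
        using fin(2) by (simp add: t_def)
      moreover have "a \<in> z \<longleftrightarrow> t < p a" for a
      proof
        assume "a \<in> z"
        then show "t < p a"
          using fin(2) that gap[of z a] p(3)[of a] by (auto simp: t_def p_def)
      next
        assume t: "t < p a"
        with \<open>0 \<le> t\<close> have "a \<in> {a. p a \<noteq> 0}"
          by simp
        with p(2) have "a \<in> \<Union>K"
          by (rule UnionI)
        then have "p a \<le> t" if "a \<notin> z"
          using that fin(2) by (simp add: t_def)
        with t show "a \<in> z"
          by linarith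
      qed
      ultimately have "z \<noteq> {} \<and> (\<exists>t\<ge>0. z = {a. t < p a})"
        using zK(3) by (auto intro!: exI[of _ t])
      then show ?thesis
        using q(2) by auto
    qed
    have qK: "{z. q z \<noteq> 0} \<subseteq> K"
    proof
      fix z assume "z \<in> {z. q z \<noteq> 0}"
      then have "z \<noteq> {}" "z \<subseteq> {a. p a \<noteq> 0}"
        using q(2) by auto
      then show "z \<in> K"
        using p(2) K unfolding finite_abstract_simplicial_complex_def by blast
    qed
    have "s \<subseteq> t \<or> t \<subseteq> s" if st: "q s \<noteq> 0" "q t \<noteq> 0" for s t
    proof -
      have "s \<in> {z. z \<noteq> {} \<and> (\<exists>t\<ge>0. z = {a. t < p a})}" "t \<in> {z. z \<noteq> {} \<and> (\<exists>t\<ge>0. z = {a. t < p a})}"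
        using st by (simp_all flip: q(2))
      then obtain l m where "s = {a. l < p a}" "t = {a. m < p a}"
        by auto
      then show ?thesis
        by (cases "l \<le> m") auto
    qed
    then have q_chain: "chain\<^sub>\<subseteq> {z. q z \<noteq> 0}"
      by (auto simp: chain_subset_def)
    \<comment> \<open>Multiplication by \<open>card z\<close> undoes the division in
      \<open>barycentric_map\<close>, so \<open>f\<close> is a preimage of \<open>p\<close>;
      removing the shift \<open>c * u\<close> from it will give a preimage of
      \<open>w\<close>.\<close>
    define f where "f z = real (card z) * q z" for z
    have f_supp: "{z. f z \<noteq> 0} = {z. q z \<noteq> 0}"
    proof -
      have "card z \<noteq> 0" if "q z \<noteq> 0" for z
        using that qK simplex[of z] by (auto simp: card_gt_0_iff)
      then show ?thesis
        by (auto simp: f_def)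
    qed
    have "?b f = layer_sum K q"
      unfolding barycentric_map_def layer_sum_def
      by (intro ext sum.cong) (use simplex in \<open>auto simp: f_def\<close>)
    then have bf: "?b f = p"
      using q(3) by simp
    have "0 \<le> f z" for z
      using q(1) by (simp add: f_def)
    moreover have "x \<subseteq> {z. q z \<noteq> 0}"
      using \<open>\<And>z. z \<in> x \<Longrightarrow> q z \<noteq> 0\<close> by blast
    ultimately have f_star: "f \<in> open_star_cone ?W x"
      using x_props(1) qK q_chain
      unfolding open_star_cone_def mem_Collect_eq f_supp whitney_barycentric_graph_iff[OF fin(1)]
      by blast
    define v where "v z = f z - c * u z" for z
    have f_eq: "f = (\<lambda>z. v z + c * u z)"
      by (simp add: v_def fun_eq_iff)
    have bv: "?b v = w"
      using lin[of v c] bf unfolding f_eq[symmetric] by (simp add: fun_eq_iff p_def)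
    have "v \<in> tangent_cone ?W x"
      by (rule open_star_tangent_cone[OF f_star[unfolded f_eq] u0])
        (use w in \<open>simp_all add: sumW bv tangent_cone_def\<close>)
    then show ?thesis
      using bv by blast
  qed
  ultimately show ?thesis
    unfolding bij_betw_def by blast
qed

section \<open>Compactness of links and passage from cones to links\<close>

text \<open>The type class \<open>t2_space\<close> is instantiated for functions on countable types only, so
  \<open>homeomorphic_compact\<close> does not apply.\<close>
lemma homeomorphic_compact_fun:
  fixes f :: "'a::topological_space \<Rightarrow> 'b \<Rightarrow> real"
  assumes "compact S" "continuous_on S f" "f ` S = T" "inj_on f S"
  shows "S homeomorphic T"
proof -
  have "Hausdorff_space (euclidean :: ('b \<Rightarrow> real) topology)"
    by (simp add: Hausdorff_space_product_topology flip: euclidean_product_topology)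
  then have "homeomorphic_map (top_of_set S) (top_of_set T) f"
    using assms
    by (intro continuous_imp_homeomorphic_map)
      (auto simp: compact_space_subtopology Hausdorff_space_subtopology)
  then obtain g where g: "homeomorphic_maps (top_of_set S) (top_of_set T) f g"
    by (auto simp: homeomorphic_map_maps)
  then have "continuous_on T g" "g ` T = S"
    "\<And>x. x \<in> S \<Longrightarrow> g (f x) = x" "\<And>y. y \<in> T \<Longrightarrow> f (g y) = y"
    by (auto simp: homeomorphic_maps_def image_iff Pi_iff) metis
  then show ?thesis
    using assms by (intro homeomorphicI[of f S T g])
qed

text \<open>The support condition is split over the finitely many simplices \<open>t\<close>
  containing \<open>s\<close>: vanishing outside \<open>t\<close> is a closed condition. The norm
  bound, with coordinates off the vertex set fixed at \<open>0\<close>, confines the link to a box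
  that is compact by Tychonoff.\<close>

lemma compact_tangent_link:
  assumes K: "finite_abstract_simplicial_complex K"
  shows "compact (tangent_link K s)"
proof -
  let ?V = "\<Union>K"
  note fin = finite_complex[OF K] finite_Union_complex[OF K]
  define B where "B = (\<Pi>\<^sub>E a\<in>UNIV. if a \<in> ?V then {-1..1} else {0::real})"
  have "compactin (product_topology (\<lambda>i. euclidean) UNIV) B"
    unfolding B_def by (subst compactin_PiE) auto
  then have "compact B"
    by (simp add: euclidean_product_topology)
  define C where "C t = {v :: 'a \<Rightarrow> real. (\<forall>a\<in>-s. 0 \<le> v a) \<and> (\<forall>a\<in>-t. v a = 0) \<and>
      sum v ?V = 0 \<and> (\<Sum>a\<in>?V. \<bar>v a\<bar>) = 1}" for t
  have "closed (C t)" for t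
    unfolding C_def Ball_def
    by (intro closed_Collect_conj closed_Collect_all closed_Collect_imp closed_Collect_le
        closed_Collect_eq continuous_intros) auto
  moreover have "tangent_link K s = (\<Union>t\<in>{t \<in> K. s \<subseteq> t}. C t \<inter> B)"
  proof (intro equalityI subsetI)
    fix v assume v: "v \<in> tangent_link K s"
    have "\<bar>v a\<bar> \<le> 1" if "a \<in> ?V" for a
      using member_le_sum[of a ?V "\<lambda>a. \<bar>v a\<bar>"] that fin(2) v by (simp add: tangent_link_def)
    moreover have "v a = 0" if "a \<notin> ?V" for a
      using that v tangent_cone_support by (fastforce simp: tangent_link_def)
    ultimately have "v \<in> B"
      by (auto simp: B_def abs_le_iff)
    moreover have "v \<in> C (s \<union> {a. v a \<noteq> 0})" "s \<union> {a. v a \<noteq> 0} \<in> K"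
      using v by (auto simp: C_def tangent_link_def tangent_cone_def)
    ultimately show "v \<in> (\<Union>t\<in>{t \<in> K. s \<subseteq> t}. C t \<inter> B)"
      by (intro UN_I[of "s \<union> {a. v a \<noteq> 0}"]) auto
  next
    fix v assume "v \<in> (\<Union>t\<in>{t \<in> K. s \<subseteq> t}. C t \<inter> B)"
    then obtain t where t: "t \<in> K" "s \<subseteq> t" "v \<in> C t"
      by auto
    moreover have "s \<union> {a. v a \<noteq> 0} \<subseteq> t"
      using t by (auto simp: C_def)
    \<comment> \<open>Norm 1 excludes the zero vector, so the union with \<open>s\<close> is
      nonempty even if \<open>s\<close> is empty, as membership in \<open>K\<close>
      requires.\<close>
    moreover have "{a. v a \<noteq> 0} \<noteq> {}"
    proof
      assume "{a. v a \<noteq> 0} = {}"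
      then have "v a = 0" for a
        by auto
      then show False
        using t(3) by (simp add: C_def)
    qed
    ultimately have "s \<union> {a. v a \<noteq> 0} \<in> K"
      using K unfolding finite_abstract_simplicial_complex_def by blast
    then show "v \<in> tangent_link K s"
      using t(3) by (auto simp: tangent_link_def tangent_cone_def C_def)
  qed
  ultimately show ?thesis
    using fin(1) \<open>compact B\<close> by (auto intro!: compact_UN closed_Int_compact)
qed

text \<open>A linear bijection of cones carries rays to rays. Followed by normalization it is a
  continuous bijection of links, and compactness of the source makes it a homeomorphism.\<close>

lemma tangent_link_homeomorphic_barycentric:
  assumes K: "finite_abstract_simplicial_complex K"
    and x: "x \<in> whitney_complex (barycentric_graph K)"
  shows "tangent_link (whitney_complex (barycentric_graph K)) x homeomorphic
    tangent_link K (\<Union>x)"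
proof -
  let ?W = "whitney_complex (barycentric_graph K)"
  let ?T = "tangent_cone ?W x" and ?T' = "tangent_cone K (\<Union>x)"
  let ?b = "barycentric_map K"
  define nm where "nm v = (\<Sum>a\<in>\<Union>K. \<bar>v a\<bar>)" for v :: "'a \<Rightarrow> real"
  define nW where "nW v = (\<Sum>a\<in>\<Union>?W. \<bar>v a\<bar>)" for v :: "'a set \<Rightarrow> real"
  have W: "finite_abstract_simplicial_complex ?W"
    by (intro finite_abstract_simplicial_complex_whitney_complex graph_barycentric_graph
        finite_complex[OF K])
  note fin = finite_Union_complex[OF K] finite_Union_complex[OF W]
  have inj: "inj_on ?b ?T" and img: "?b ` ?T = ?T'"
    using barycentric_map_bij_betw_tangent_cone[OF K x] by (auto simp: bij_betw_def)
  have b0: "?b (\<lambda>z. 0) = (\<lambda>a. 0)"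
    by (simp add: barycentric_map_def)
  have nm_nonneg: "0 \<le> nm v" and nW_nonneg: "0 \<le> nW w" for v w
    by (simp_all add: nm_def nW_def sum_nonneg)
  have nm0: "v = (\<lambda>a. 0)" if "v \<in> ?T'" "nm v = 0" for v
  proof
    fix a
    have "\<forall>a\<in>\<Union>K. \<bar>v a\<bar> = 0"
      using that(2) unfolding nm_def by (subst (asm) sum_nonneg_eq_0_iff[OF fin(1)]) auto
    then show "v a = 0"
      using tangent_cone_support[OF that(1), of a] by auto
  qed
  have nW0: "v = (\<lambda>a. 0)" if "v \<in> ?T" "nW v = 0" for v
  proof
    fix z
    have "\<forall>z\<in>\<Union>?W. \<bar>v z\<bar> = 0"
      using that(2) unfolding nW_def by (subst (asm) sum_nonneg_eq_0_iff[OF fin(2)]) auto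
    then show "v z = 0"
      using tangent_cone_support[OF that(1), of z] by auto
  qed
  have nm_scale: "nm (\<lambda>a. c * v a) = c * nm v" if "0 < c" for c v
    using that by (simp add: nm_def abs_mult sum_distrib_left)
  have nW_scale: "nW (\<lambda>a. c * v a) = c * nW v" if "0 < c" for c v
    using that by (simp add: nW_def abs_mult sum_distrib_left)
  \<comment> \<open>The zero vector lies in the cone, so by injectivity no other vector is sent to
    zero and the normalization is defined.\<close>
  have pos: "0 < nm (?b v)" if "v \<in> ?T" "nW v = 1" for v
  proof -
    have "?b v \<in> ?T'"
      using img that(1) by blast
    moreover have "(\<lambda>z. 0) \<in> ?T" if "?b v = (\<lambda>a. 0)"
      using \<open>v \<in> ?T\<close> x by (auto simp: tangent_cone_def)
    moreover have "v \<noteq> (\<lambda>z. 0)"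
      using that(2) by (auto simp: nW_def)
    ultimately have "nm (?b v) \<noteq> 0"
      using nm0[of "?b v"] inj_onD[OF inj, of v "\<lambda>z. 0"] that(1) b0 by metis
    then show ?thesis
      using nm_nonneg[of "?b v"] by linarith
  qed
  define F where "F v = (\<lambda>a. inverse (nm (?b v)) * ?b v a)" for v
  have link: "v \<in> tangent_link ?W x \<longleftrightarrow> v \<in> ?T \<and> nW v = 1"
    and link': "w \<in> tangent_link K (\<Union>x) \<longleftrightarrow> w \<in> ?T' \<and> nm w = 1" for v w
    by (simp_all add: tangent_link_def nW_def nm_def)
  have F_eq: "F v = ?b (\<lambda>z. inverse (nm (?b v)) * v z)" for v
    by (simp add: F_def barycentric_map_scale)
  have coord: "continuous_on A (\<lambda>v. ?b v a)" for A a
    using continuous_on_barycentric_map by (rule continuous_on_product_then_coordinatewise)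
  have "continuous_on (tangent_link ?W x) F"
    unfolding F_def
    by (intro continuous_on_coordinatewise_then_product continuous_intros coord)
      (use pos in \<open>force simp: nm_def link intro!: continuous_intros coord\<close>)+
  moreover have "inj_on F (tangent_link ?W x)"
  proof (rule inj_onI)
    fix v w assume vw: "v \<in> tangent_link ?W x" "w \<in> tangent_link ?W x" and eq: "F v = F w"
    have ps: "0 < inverse (nm (?b v))" "0 < inverse (nm (?b w))"
      using vw pos by (auto simp: link)
    \<comment> \<open>By linearity the normalizing factors can be moved inside the map, so
      \<open>v\<close> and \<open>w\<close> span the same ray. Both have norm 1, which makes the
      factors equal.\<close>
    have "(\<lambda>z. inverse (nm (?b v)) * v z) = (\<lambda>z. inverse (nm (?b w)) * w z)"
      using eq vw ps unfolding F_eq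
      by (intro inj_onD[OF inj]) (auto simp: link intro: tangent_cone_scale)
    moreover from this have "inverse (nm (?b v)) = inverse (nm (?b w))"
      using nW_scale[OF ps(1), of v] nW_scale[OF ps(2), of w] vw by (simp add: link)
    ultimately show "v = w"
      using ps by (simp add: fun_eq_iff)
  qed
  moreover have "F ` tangent_link ?W x = tangent_link K (\<Union>x)"
  proof (intro equalityI subsetI)
    fix w assume "w \<in> F ` tangent_link ?W x"
    then obtain v where v: "v \<in> ?T" "nW v = 1" "w = F v"
      by (auto simp: link)
    have "?b v \<in> ?T'"
      using img v(1) by blast
    then show "w \<in> tangent_link K (\<Union>x)"
      using pos[OF v(1,2)] unfolding link' v(3) F_def
      by (auto intro: tangent_cone_scale simp: nm_scale)
  next
    fix w assume w: "w \<in> tangent_link K (\<Union>x)"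
    then have "w \<in> ?b ` ?T"
      using img by (simp add: link')
    then obtain v where v: "v \<in> ?T" "?b v = w"
      by auto
    have "nW v \<noteq> 0"
      using nW0[OF v(1)] v(2) w b0 by (auto simp: link' nm_def)
    then have n: "0 < inverse (nW v)"
      using nW_nonneg[of v] by simp
    let ?v = "\<lambda>z. inverse (nW v) * v z"
    have "?v \<in> tangent_link ?W x"
      using n v(1) by (auto simp: link nW_scale intro: tangent_cone_scale)
    moreover have "F ?v = w"
      using n w v(2) unfolding F_def barycentric_map_scale
      by (auto simp: nm_scale link')
    ultimately show "w \<in> F ` tangent_link ?W x"
      by blast
  qed
  ultimately show ?thesis
    using homeomorphic_compact_fun[OF compact_tangent_link[OF W]] by blast
qed

section \<open>Unit spheres of graphs as links of vertices\<close>

text \<open>A clique among the neighbors of \<open>y\<close> stays a clique when \<open>y\<close> is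
  added. The Whitney complex of the unit sphere is thus the simplicial link of
  \<open>y\<close>.\<close>

lemma whitney_unit_sphere_iff:
  assumes "graph H" and y: "y \<in> verts H"
  shows "A \<in> whitney_complex (unit_sphere H y) \<longleftrightarrow>
    A \<noteq> {} \<and> y \<notin> A \<and> insert y A \<in> whitney_complex H"
proof -
  interpret graph H by fact
  have dom: "u \<rightarrow>\<^bsub>unit_sphere H y\<^esub> v \<longleftrightarrow> y \<rightarrow>\<^bsub>H\<^esub> u \<and> y \<rightarrow>\<^bsub>H\<^esub> v \<and> u \<rightarrow>\<^bsub>H\<^esub> v" for u v
  proof -
    have "arcs_ends (unit_sphere H y) = {(u, v) \<in> arcs_ends H. y \<rightarrow>\<^bsub>H\<^esub> u \<and> y \<rightarrow>\<^bsub>H\<^esub> v}"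
      by (auto simp: unit_sphere_def arcs_ends_def arc_to_ends_def)
    then show ?thesis
      by auto
  qed
  have "A \<subseteq> {u. y \<rightarrow>\<^bsub>H\<^esub> u} \<longleftrightarrow>
      y \<notin> A \<and> A \<subseteq> verts H \<and> (\<forall>v\<in>A. y \<noteq> v \<longrightarrow> y \<rightarrow>\<^bsub>H\<^esub> v \<and> v \<rightarrow>\<^bsub>H\<^esub> y)"
  proof
    assume "A \<subseteq> {u. y \<rightarrow>\<^bsub>H\<^esub> u}"
    then have nbr: "y \<rightarrow>\<^bsub>H\<^esub> v" if "v \<in> A" for v
      using that by auto
    then have "v \<noteq> y" "v \<in> verts H" "v \<rightarrow>\<^bsub>H\<^esub> y" if "v \<in> A" for v
      using nbr[OF that] adj_not_same adj_in_verts(2)[OF nbr[OF that]]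
        graph_symmetric[OF nbr[OF that]] by auto
    with nbr show "y \<notin> A \<and> A \<subseteq> verts H \<and> (\<forall>v\<in>A. y \<noteq> v \<longrightarrow> y \<rightarrow>\<^bsub>H\<^esub> v \<and> v \<rightarrow>\<^bsub>H\<^esub> y)"
      by auto
  qed auto
  then show ?thesis
    unfolding whitney_complex_iff[OF assms(1)] whitney_complex_iff[OF graph_unit_sphere[OF assms(1)]]
      dom verts_unit_sphere
    using y by auto
qed

lemma Union_whitney_complex:
  assumes "graph H"
  shows "\<Union>(whitney_complex H) = verts H"
proof -
  have "{u} \<in> whitney_complex H" if "u \<in> verts H" for u
    using that by (simp add: whitney_complex_iff[OF assms])
  moreover have "A \<subseteq> verts H" if "A \<in> whitney_complex H" for A
    using that by (simp add: whitney_complex_iff[OF assms])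
  ultimately show ?thesis
    by blast
qed

text \<open>A tangent vector at the vertex \<open>y\<close> is nonnegative off \<open>y\<close>, and
  its coordinate at \<open>y\<close> balances the others. Norm 1 forces \<open>-1/2\<close> at
  \<open>y\<close> and total \<open>1/2\<close> elsewhere, so doubling the remaining coordinates
  gives barycentric coordinates on the sphere.\<close>

lemma unit_sphere_homeomorphic_tangent_link:
  assumes H: "graph H" and y: "y \<in> verts H"
  shows "geometric_realization (whitney_complex (unit_sphere H y)) homeomorphic
    tangent_link (whitney_complex H) {y}"
proof -
  interpret graph H by fact
  let ?R = "geometric_realization (whitney_complex (unit_sphere H y))"
  let ?N = "tangent_link (whitney_complex H) {y}"
  define F where "F f = (\<lambda>z. (if z = y then -1 else f z) / 2)" for f :: "'a \<Rightarrow> real"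
  define E where "E v = (\<lambda>z. if z = y then 0 else 2 * v z)" for v :: "'a \<Rightarrow> real"
  note iff = whitney_unit_sphere_iff[OF H y] Union_whitney_complex[OF H]
  have sum_y: "sum g (verts H) = g y + sum g (verts H - {y})" for g :: "'a \<Rightarrow> real"
    using y by (simp add: sum.remove)
  have Wsub: "A \<subseteq> verts H" if "A \<in> whitney_complex H" for A
    using that by (simp add: whitney_complex_def)
  have F: "F f \<in> ?N" "E (F f) = f" if f: "f \<in> ?R" for f
  proof -
    have supp: "insert y {z. f z \<noteq> 0} \<in> whitney_complex H" and fy: "f y = 0"
      and nonneg: "\<And>z. 0 \<le> f z" and one: "sum f {z. f z \<noteq> 0} = 1"
      using f by (auto simp: geometric_realization_def iff)
    have "sum f (verts H - {y}) = sum f {z. f z \<noteq> 0}"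
      by (rule sum.mono_neutral_right) (use Wsub[OF supp] fy in auto)
    then have s: "sum f (verts H - {y}) = 1"
      using one by simp
    have "sum (F f) (verts H - {y}) = 1 / 2" "(\<Sum>z\<in>verts H - {y}. \<bar>F f z\<bar>) = 1 / 2"
      using s nonneg by (simp_all add: F_def flip: sum_divide_distrib)
    moreover have "{y} \<union> {z. F f z \<noteq> 0} = insert y {z. f z \<noteq> 0}"
      by (auto simp: F_def)
    ultimately show "F f \<in> ?N"
      using supp nonneg unfolding tangent_link_def tangent_cone_def iff sum_y
      by (auto simp: F_def)
    show "E (F f) = f"
      using fy by (auto simp: E_def F_def)
  qed
  have E: "E v \<in> ?R" "F (E v) = v" if v: "v \<in> ?N" for v
  proof -
    have supp: "insert y {z. v z \<noteq> 0} \<in> whitney_complex H" and nonneg: "\<And>z. z \<noteq> y \<Longrightarrow> 0 \<le> v z"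
      and zero: "v y + sum v (verts H - {y}) = 0"
      and one: "\<bar>v y\<bar> + (\<Sum>z\<in>verts H - {y}. \<bar>v z\<bar>) = 1"
      using v by (auto simp: tangent_link_def tangent_cone_def iff sum_y)
    have "(\<Sum>z\<in>verts H - {y}. \<bar>v z\<bar>) = sum v (verts H - {y})"
      by (intro sum.cong) (auto simp: nonneg)
    moreover have "0 \<le> sum v (verts H - {y})"
      by (intro sum_nonneg) (auto simp: nonneg)
    ultimately have vy: "v y = - 1 / 2" and s: "sum v (verts H - {y}) = 1 / 2"
      using zero one by linarith+
    have supp_E: "{z. E v z \<noteq> 0} = {z. v z \<noteq> 0} - {y}"
      by (auto simp: E_def)
    have "sum (E v) {z. E v z \<noteq> 0} = sum (E v) (verts H - {y})"
      by (rule sum.mono_neutral_left) (use Wsub[OF supp] in \<open>auto simp: supp_E\<close>, auto simp: E_def)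
    also have "\<dots> = 2 * sum v (verts H - {y})"
      by (simp add: E_def sum_distrib_left)
    finally have sumE: "sum (E v) {z. E v z \<noteq> 0} = 1"
      using s by simp
    then have "{z. E v z \<noteq> 0} \<noteq> {}"
      by force
    moreover have "insert y {z. E v z \<noteq> 0} = insert y {z. v z \<noteq> 0}"
      using supp_E by blast
    ultimately have "{z. E v z \<noteq> 0} \<in> whitney_complex (unit_sphere H y)"
      using supp by (simp add: iff E_def)
    then show "E v \<in> ?R"
      using sumE nonneg by (auto simp: geometric_realization_def E_def)
    show "F (E v) = v"
      using vy by (auto simp: E_def F_def)
  qed
  have "continuous_on ?R F"
    unfolding F_def
  proof (rule continuous_on_coordinatewise_then_product)
    fix z
    show "continuous_on ?R (\<lambda>f. (if z = y then - 1 else f z) / 2)"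
      by (cases "z = y") (auto intro!: continuous_intros)
  qed
  moreover have "continuous_on ?N E"
    unfolding E_def
  proof (rule continuous_on_coordinatewise_then_product)
    fix z
    show "continuous_on ?N (\<lambda>v. if z = y then 0 else 2 * v z)"
      by (cases "z = y") (auto intro!: continuous_intros)
  qed
  ultimately have "homeomorphism ?R ?N F E"
    using F E by (intro homeomorphismI) auto
  then show ?thesis
    unfolding homeomorphic_def by blast
qed

text \<open>The sphere is the tangent link of the subdivision at the one-element chain
  \<open>{x}\<close>, which the subdivision map identifies with the link at
  \<open>\<Union>{x} = x\<close>.\<close>

lemma barycentric_unit_sphere_homeomorphic:
  assumes K: "finite_abstract_simplicial_complex K" and x: "x \<in> K"
  shows "geometric_realization (whitney_complex (unit_sphere (barycentric_graph K) x)) homeomorphic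
    tangent_link K x"
proof -
  note fin = finite_complex[OF K]
  have "{x} \<in> whitney_complex (barycentric_graph K)"
    using x by (simp add: whitney_barycentric_graph_iff[OF fin] chain_subset_def)
  then show ?thesis
    using homeomorphic_trans[OF unit_sphere_homeomorphic_tangent_link[OF graph_barycentric_graph[OF fin]]
        tangent_link_homeomorphic_barycentric[OF K]] x by fastforce
qed

section \<open>Comparison of the unit spheres in the two refinements\<close>

lemma unit_sphere_refinement_equivalent:
  assumes G: "finite_abstract_simplicial_complex G"
    and x: "x \<in> whitney_complex (barycentric_graph G)"
  shows "topologically_equivalent
    (unit_sphere (barycentric_refinement (barycentric_graph G)) x)
    (unit_sphere (barycentric_graph G) (\<Union>x))"
    and "\<Union>x \<in> G"
proof -
  note fin = finite_complex[OF G]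
  have x_props: "x \<noteq> {}" "x \<subseteq> G" "chain\<^sub>\<subseteq> x"
    using x by (auto simp: whitney_barycentric_graph_iff[OF fin])
  then show top: "\<Union>x \<in> G"
    using Union_chain_mem[of x] fin finite_subset by blast
  \<comment> \<open>Here the complex is the Whitney complex of the first refinement, in which the
    chain \<open>x\<close> is itself a simplex. The next step descends to \<open>G\<close>.\<close>
  have "geometric_realization (whitney_complex
      (unit_sphere (barycentric_refinement (barycentric_graph G)) x)) homeomorphic
    tangent_link (whitney_complex (barycentric_graph G)) x"
    unfolding barycentric_refinement_def
    using finite_abstract_simplicial_complex_whitney_complex[OF graph_barycentric_graph[OF fin]] x
    by (rule barycentric_unit_sphere_homeomorphic)
  also have "\<dots> homeomorphic tangent_link G (\<Union>x)"
    by (rule tangent_link_homeomorphic_barycentric[OF G x])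
  also have "\<dots> homeomorphic
      geometric_realization (whitney_complex (unit_sphere (barycentric_graph G) (\<Union>x)))"
    using barycentric_unit_sphere_homeomorphic[OF G top] by (rule homeomorphic_sym[THEN iffD1])
  finally show "topologically_equivalent
      (unit_sphere (barycentric_refinement (barycentric_graph G)) x)
      (unit_sphere (barycentric_graph G) (\<Union>x))"
    by (simp add: topologically_equivalent_def)
qed

theorem theorem1:
  fixes G :: "'a set set"
  assumes "finite_abstract_simplicial_complex G"
  shows "(\<forall>y \<in> verts (barycentric_graph G).
            \<exists>x \<in> verts (barycentric_refinement (barycentric_graph G)).
              topologically_equivalent
                (unit_sphere (barycentric_graph G) y)
                (unit_sphere (barycentric_refinement (barycentric_graph G)) x)) \<and>
         (\<forall>x \<in> verts (barycentric_refinement (barycentric_graph G)).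
            \<exists>y \<in> verts (barycentric_graph G).
              topologically_equivalent
                (unit_sphere (barycentric_refinement (barycentric_graph G)) x)
                (unit_sphere (barycentric_graph G) y))"
proof -
  have verts: "verts (barycentric_refinement (barycentric_graph G)) =
      whitney_complex (barycentric_graph G)"
    by (simp add: barycentric_refinement_def)
  have "{y} \<in> whitney_complex (barycentric_graph G)" if "y \<in> G" for y
    using that finite_complex[OF assms] by (simp add: whitney_barycentric_graph_iff chain_subset_def)
  then show ?thesis
    using unit_sphere_refinement_equivalent[OF assms]
    unfolding verts verts_barycentric_graph topologically_equivalent_def
    by (metis ccpo_Sup_singleton homeomorphic_sym)
qed

end
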